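(* Let $\mathcal{M}$ be a smooth manifold. Consider the dynamical system $x_{t+1} = g(x_t)$ with $C^1$ iteration map $g \colon \mathcal{M} \to \mathcal{M}$. Assume that the differential $\mathrm{D}g(x) \colon \mathrm{T}_x\mathcal{M} \to \mathrm{T}_{g(x)}\mathcal{M}$ is invertible for almost all $x \in \mathcal{M}$. Then the set of initial points $x_0 \in \mathcal{M}$ such that the sequence $(x_t)_{t \ge 0}$ converges to an unstable fixed point of $g$ has measure zero in $\mathcal{M}$.
   Context: Manifolds are finite-dimensional, Hausdorff and second countable. A subset $A$ of a smooth $n$-dimensional manifold $\mathcal{M}$ has measure zero if for every smooth chart $(U,\varphi)$ the set $\varphi(A\cap U) \subseteq \mathbb{R}^n$ has Lebesgue measure zero; "almost all" means all outside a measure-zero set. A point $x^*$ is an unstable fixed point of $g$ if $g(x^* ) = x^*$ and $\mathrm{D}g(x^* )$ has at least one (possibly complex) eigenvalue $\lambda$ with $|\lambda| > 1$. *)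

theory Defs
  imports "HOL-Analysis.Analysis"
begin

text \<open>\<open>Ck_on k S f\<close> is meant for open \<open>S\<close> in a finite-dimensional space: \<open>f\<close> is \<open>k\<close> times
  continuously differentiable on \<open>S\<close>, expressed through iterated directional derivatives.\<close>

fun Ck_on :: "nat \<Rightarrow> 'a::euclidean_space set \<Rightarrow> ('a \<Rightarrow> 'b::real_normed_vector) \<Rightarrow> bool" where
  "Ck_on 0 S f \<longleftrightarrow> continuous_on S f"
| "Ck_on (Suc k) S f \<longleftrightarrow>
     (\<forall>x\<in>S. f differentiable (at x)) \<and>
     (\<forall>v. Ck_on k S (\<lambda>x. frechet_derivative f (at x) v))"

definition smooth_on :: "'a::euclidean_space set \<Rightarrow> ('a \<Rightarrow> 'b::real_normed_vector) \<Rightarrow> bool" where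
  "smooth_on S f \<longleftrightarrow> (\<forall>k. Ck_on k S f)"

text \<open>A chart \<open>(U, \<phi>)\<close>; only the values of \<open>\<phi>\<close> on \<open>U\<close> matter.\<close>

type_synonym ('a, 'n) chart = "'a set \<times> ('a \<Rightarrow> real ^ 'n)"

definition is_chart :: "'a topology \<Rightarrow> ('a, 'n::finite) chart \<Rightarrow> bool" where
  "is_chart X c \<longleftrightarrow> openin X (fst c) \<and> open (snd c ` fst c) \<and>
     homeomorphic_map (subtopology X (fst c)) (top_of_set (snd c ` fst c)) (snd c)"

text \<open>The local representative \<open>\<psi> \<circ> g \<circ> \<phi>\<^sup>-\<^sup>1\<close> of \<open>g\<close> in the charts \<open>c = (U, \<phi>)\<close> and
  \<open>d = (V, \<psi>)\<close>, meaningful on \<open>\<phi> ` (U \<inter> g -` V)\<close>.\<close>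

definition local_rep ::
  "('a, 'm::finite) chart \<Rightarrow> ('b, 'n::finite) chart \<Rightarrow> ('a \<Rightarrow> 'b) \<Rightarrow> real ^ 'm \<Rightarrow> real ^ 'n" where
  "local_rep c d g = snd d \<circ> g \<circ> inv_into (fst c) (snd c)"

definition compatible :: "('a, 'n::finite) chart \<Rightarrow> ('a, 'n) chart \<Rightarrow> bool" where
  "compatible c d \<longleftrightarrow>
     smooth_on (snd c ` (fst c \<inter> fst d)) (local_rep c d id) \<and>
     smooth_on (snd d ` (fst c \<inter> fst d)) (local_rep d c id)"

text \<open>The manifold has underlying space \<open>X\<close> and dimension \<open>CARD('n)\<close>; its smooth structure \<open>\<A>\<close> is
  a maximal atlas, i.e. the set of all smooth charts.\<close>

definition smooth_manifold :: "'a topology \<Rightarrow> ('a, 'n::finite) chart set \<Rightarrow> bool" where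
  "smooth_manifold X \<A> \<longleftrightarrow>
     Hausdorff_space X \<and> second_countable X \<and>
     (\<forall>c\<in>\<A>. is_chart X c) \<and>
     (\<Union>c\<in>\<A>. fst c) = topspace X \<and>
     (\<forall>c\<in>\<A>. \<forall>d\<in>\<A>. compatible c d) \<and>
     (\<forall>c. is_chart X c \<and> (\<forall>d\<in>\<A>. compatible c d) \<longrightarrow> c \<in> \<A>)"

definition C1_map ::
  "'a topology \<Rightarrow> ('a, 'm::finite) chart set \<Rightarrow> 'b topology \<Rightarrow> ('b, 'n::finite) chart set \<Rightarrow>
   ('a \<Rightarrow> 'b) \<Rightarrow> bool" where
  "C1_map X \<A> Y \<B> g \<longleftrightarrow>
     continuous_map X Y g \<and>
     (\<forall>c\<in>\<A>. \<forall>d\<in>\<B>. Ck_on 1 (snd c ` (fst c \<inter> g -` fst d)) (local_rep c d g))"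

definition measure_zero :: "'a topology \<Rightarrow> ('a, 'n::finite) chart set \<Rightarrow> 'a set \<Rightarrow> bool" where
  "measure_zero X \<A> S \<longleftrightarrow>
     S \<subseteq> topspace X \<and> (\<forall>c\<in>\<A>. snd c ` (S \<inter> fst c) \<in> null_sets lebesgue)"

definition almost_all :: "'a topology \<Rightarrow> ('a, 'n::finite) chart set \<Rightarrow> ('a \<Rightarrow> bool) \<Rightarrow> bool" where
  "almost_all X \<A> P \<longleftrightarrow> measure_zero X \<A> {x \<in> topspace X. \<not> P x}"

definition charts_at :: "('a, 'n) chart set \<Rightarrow> 'a \<Rightarrow> ('a, 'n) chart set" where
  "charts_at \<A> x = {c \<in> \<A>. x \<in> fst c}"

text \<open>A tangent vector at \<open>x\<close> is the family of its coordinate vectors in the charts around \<open>x\<close>, which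
  transform by the derivatives of the transition maps. The vector space operations are pointwise;
  the value \<open>0\<close> at all other charts only makes the family a unique function.\<close>

definition tangent_space ::
  "('a, 'n::finite) chart set \<Rightarrow> 'a \<Rightarrow> (('a, 'n) chart \<Rightarrow> real ^ 'n) set" where
  "tangent_space \<A> x =
     {v. (\<forall>c. c \<notin> charts_at \<A> x \<longrightarrow> v c = 0) \<and>
         (\<forall>c\<in>charts_at \<A> x. \<forall>d\<in>charts_at \<A> x.
            v d = frechet_derivative (local_rep c d id) (at (snd c x)) (v c))}"

text \<open>\<open>\<D>g(x)\<close>: the coordinates of the image vector in the chart \<open>d\<close> around \<open>g x\<close> are computed from
  any chart around \<open>x\<close>; by the chain rule the choice is immaterial for tangent vectors.\<close>

definition differential ::
  "('a, 'm::finite) chart set \<Rightarrow> ('b, 'n::finite) chart set \<Rightarrow> ('a \<Rightarrow> 'b) \<Rightarrow> 'a \<Rightarrow>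
   (('a, 'm) chart \<Rightarrow> real ^ 'm) \<Rightarrow> (('b, 'n) chart \<Rightarrow> real ^ 'n)" where
  "differential \<A> \<B> g x v =
     (let c = (SOME c. c \<in> charts_at \<A> x) in
      (\<lambda>d. if d \<in> charts_at \<B> (g x)
          then frechet_derivative (local_rep c d g) (at (snd c x)) (v c) else 0))"

definition invertible_differential ::
  "('a, 'm::finite) chart set \<Rightarrow> ('b, 'n::finite) chart set \<Rightarrow> ('a \<Rightarrow> 'b) \<Rightarrow> 'a \<Rightarrow> bool" where
  "invertible_differential \<A> \<B> g x \<longleftrightarrow>
     bij_betw (differential \<A> \<B> g x) (tangent_space \<A> x) (tangent_space \<B> (g x))"

text \<open>At a fixed point \<open>x\<close>, the number \<open>\<mu>\<close> is an eigenvalue of the complexified endomorphism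
  \<open>\<D>g(x)\<close>, with eigenvector \<open>u + \<i>w\<close>, where \<open>u\<close> and \<open>w\<close> are real tangent vectors: the two
  equations are the real and imaginary parts of \<open>\<D>g(x)(u + \<i>w) = \<mu>(u + \<i>w)\<close>.\<close>

definition differential_eigenvalue ::
  "('a, 'n::finite) chart set \<Rightarrow> ('a \<Rightarrow> 'a) \<Rightarrow> 'a \<Rightarrow> complex \<Rightarrow> bool" where
  "differential_eigenvalue \<A> g x \<mu> \<longleftrightarrow>
     (\<exists>u\<in>tangent_space \<A> x. \<exists>w\<in>tangent_space \<A> x.
        \<not> (u = (\<lambda>_. 0) \<and> w = (\<lambda>_. 0)) \<and>
        differential \<A> \<A> g x u = (\<lambda>c. Re \<mu> *\<^sub>R u c - Im \<mu> *\<^sub>R w c) \<and>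
        differential \<A> \<A> g x w = (\<lambda>c. Im \<mu> *\<^sub>R u c + Re \<mu> *\<^sub>R w c))"

definition unstable_fixed_point ::
  "'a topology \<Rightarrow> ('a, 'n::finite) chart set \<Rightarrow> ('a \<Rightarrow> 'a) \<Rightarrow> 'a \<Rightarrow> bool" where
  "unstable_fixed_point X \<A> g x \<longleftrightarrow>
     x \<in> topspace X \<and> g x = x \<and> (\<exists>\<mu>. differential_eigenvalue \<A> g x \<mu> \<and> cmod \<mu> > 1)"

end

theory Submission
  imports Defs
begin

text \<open>No center-stable manifold is needed. In a chart around an unstable fixed point with
  differential \<open>A\<close> there is a quadratic form \<open>Q\<close>, positive somewhere, with
  \<open>Q (A x) = t Q x + \<bar>x\<bar>\<^sup>2\<close> and \<open>t > 1\<close>. By strict differentiability \<open>Q (f y - f z) \<ge> t Q (y - z)\<close>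
  for \<open>y\<close>, \<open>z\<close> in a small ball, so two orbits that stay in the ball forever satisfy
  \<open>Q (y - z) \<le> 0\<close>. Hence the translates of the closed set of such points along a vector \<open>v\<close> with
  \<open>Q v > 0\<close> are pairwise disjoint, and the set is null. Since \<open>g\<close> is a local \<open>C\<^sup>1\<close> diffeomorphism
  off a null set, preimages of null sets are null, and by the Lindelof property countably many of
  these neighbourhoods and iterates account for all orbits converging to an unstable fixed point.\<close>

subsection \<open>An expanding quadratic form\<close>

text \<open>Applying \<open>L\<close> minus \<open>r\<close> times the identity to a vanishing
  combination removes the term of the new eigenvalue \<open>r\<close> and multiplies every other
  coefficient by \<open>t - r\<close>, which is nonzero. The induction hypothesis therefore applies
  to the shorter combination.\<close>

lemma independent_eigenvectors:
  fixes L :: "'b::real_vector \<Rightarrow> 'b"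
  assumes "linear L" "finite T" "\<And>t. t \<in> T \<Longrightarrow> e t \<noteq> 0 \<and> L (e t) = t *\<^sub>R e t"
    and "(\<Sum>t\<in>T. a t *\<^sub>R e t) = 0" "s \<in> T"
  shows "a s = 0"
  using assms(2-)
proof (induction T arbitrary: a s rule: finite_induct)
  case empty
  then show ?case by simp
next
  case (insert r T)
  have "0 = L (\<Sum>t\<in>insert r T. a t *\<^sub>R e t) - r *\<^sub>R (\<Sum>t\<in>insert r T. a t *\<^sub>R e t)"
    using insert.prems(2) \<open>linear L\<close> by (simp add: linear_0)
  also have "\<dots> = (\<Sum>t\<in>insert r T. (a t * (t - r)) *\<^sub>R e t)"
    using insert.prems(1) \<open>linear L\<close>
    by (simp add: linear_sum linear_cmul scaleR_sum_right flip: sum_subtractf)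
       (rule sum.cong, auto simp: linear_cmul algebra_simps)
  also have "\<dots> = (\<Sum>t\<in>T. (a t * (t - r)) *\<^sub>R e t)"
    using insert.hyps by simp
  finally have "a t * (t - r) = 0" if "t \<in> T" for t
    using insert.IH[of "\<lambda>t. a t * (t - r)" t] insert.prems(1) that by auto
  then have aT: "a t = 0" if "t \<in> T" for t
    using that insert.hyps by auto
  then have "a r *\<^sub>R e r = 0"
    using insert.prems(2) insert.hyps by simp
  then show ?case
    using aT insert.prems(1,3) by auto
qed

text \<open>More eigenvalues than the dimension would yield too many independent eigenvectors. The
  space is an arbitrary Euclidean one because the result is applied to an operator on
  matrices.\<close>

lemma finite_eigenvalues:
  fixes L :: "'b::euclidean_space \<Rightarrow> 'b"
  assumes "linear L"
  shows "finite {t. \<exists>v. v \<noteq> 0 \<and> L v = t *\<^sub>R v}" (is "finite ?E")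
proof (rule ccontr)
  assume "infinite ?E"
  then obtain T where T: "finite T" "card T = Suc DIM('b)" "T \<subseteq> ?E"
    using infinite_arbitrarily_large by blast
  then have "\<forall>t\<in>T. \<exists>v. v \<noteq> 0 \<and> L v = t *\<^sub>R v"
    by auto
  from bchoice[OF this] obtain e where "\<forall>t\<in>T. e t \<noteq> 0 \<and> L (e t) = t *\<^sub>R e t" ..
  then have e: "e t \<noteq> 0 \<and> L (e t) = t *\<^sub>R e t" if "t \<in> T" for t
    using that by (rule bspec)
  have inj: "inj_on e T"
  proof (rule inj_onI)
    fix s t assume st: "s \<in> T" "t \<in> T" "e s = e t"
    have "s *\<^sub>R e s = t *\<^sub>R e s" "e s \<noteq> 0"
      using e[OF st(1)] e[OF st(2)] unfolding st(3) by auto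
    then show "s = t" by simp
  qed
  have "independent (e ` T)"
  proof (rule independent_if_scalars_zero)
    show "finite (e ` T)" using T by simp
    fix f x assume f: "(\<Sum>x\<in>e ` T. f x *\<^sub>R x) = 0" and "x \<in> e ` T"
    then obtain s where "s \<in> T" "x = e s" by auto
    with independent_eigenvectors[OF assms T(1) e, of "f \<circ> e" s] f inj show "f x = 0"
      by (simp add: sum.reindex)
  qed
  then show False
    using independent_bound[of "e ` T"] T card_image[OF inj] by simp
qed

text \<open>A discrete Lyapunov (Stein) equation \<open>A\<^sup>T M A - t M = 1\<close> with \<open>1 < t < \<bar>\<mu>\<bar>\<^sup>2\<close>: it is solvable
  as soon as \<open>t\<close> avoids the finitely many eigenvalues of \<open>M \<mapsto> A\<^sup>T M A\<close>. Evaluated at a complex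
  eigenvector for \<open>\<mu>\<close> it forces the form of \<open>M\<close> to be positive somewhere.\<close>

lemma expanding_form:
  fixes A :: "real^'n \<Rightarrow> real^'n::finite"
  assumes "linear A" and u: "A u = Re \<mu> *\<^sub>R u - Im \<mu> *\<^sub>R w" and w: "A w = Im \<mu> *\<^sub>R u + Re \<mu> *\<^sub>R w"
    and "u \<noteq> 0 \<or> w \<noteq> 0" "cmod \<mu> > 1"
  obtains M :: "real^'n^'n" and t v where "t > 1" "v \<bullet> (M *v v) > 0"
    "\<And>x. A x \<bullet> (M *v A x) = t * (x \<bullet> (M *v x)) + x \<bullet> x"
proof -
  let ?B = "matrix A"
  have A: "A x = ?B *v x" for x by (simp add: \<open>linear A\<close>)
  define L where "L = (\<lambda>M. transpose ?B ** M ** ?B)"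
  have L: "linear L"
    unfolding L_def
    by (rule linearI)
       (simp_all add: matrix_matrix_mult_def vec_eq_iff algebra_simps sum.distrib sum_distrib_left sum_distrib_right)
  have "1 < (cmod \<mu>)\<^sup>2"
    using \<open>cmod \<mu> > 1\<close> by (simp add: one_less_power)
  then obtain t where t: "1 < t" "t < (cmod \<mu>)\<^sup>2" "t \<notin> {t. \<exists>v. v \<noteq> 0 \<and> L v = t *\<^sub>R v}"
    using finite_eigenvalues[OF L] infinite_Ioo[of 1 "(cmod \<mu>)\<^sup>2"]
    by (metis (no_types, lifting) finite_subset greaterThanLessThan_iff subsetI)
  define K where "K = (\<lambda>M. L M - t *\<^sub>R M)"
  have K: "linear K"
    unfolding K_def using L by (intro linear_compose_sub) (auto simp: linear_iff algebra_simps)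
  have "inj K"
    unfolding linear_injective_0[OF K] using t(3) by (auto simp: K_def)
  then obtain M where "K M = mat 1"
    using linear_injective_imp_surjective[OF K] by (metis surjD)
  then have M: "L M = t *\<^sub>R M + mat 1"
    by (simp add: K_def algebra_simps)
  define Q where "Q = (\<lambda>x. x \<bullet> (M *v x))"
  have eq: "Q (A x) = t * Q x + x \<bullet> x" for x
  proof -
    have "(?B *v x) \<bullet> y = x \<bullet> (transpose ?B *v y)" for y
      by (simp add: dot_lmul_matrix inner_commute[of x] inner_commute[of _ y])
    then have "Q (A x) = x \<bullet> (transpose ?B *v (M *v (?B *v x)))"
      unfolding Q_def A[of x] by blast
    also have "\<dots> = x \<bullet> (L M *v x)"
      by (simp only: L_def matrix_vector_mul_assoc matrix_mul_assoc)
    also have "\<dots> = t * Q x + x \<bullet> x"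
      by (simp add: M Q_def matrix_vector_mult_add_rdistrib inner_add_right flip: scaleR_matrix_vector_assoc)
    finally show ?thesis .
  qed
  \<comment> \<open>This is the form evaluated at \<open>u\<close> + i\<open>w\<close>: expanding
    both terms, the mixed products of \<open>u\<close> and \<open>w\<close> cancel, for any matrix
    \<open>M\<close>.\<close>
  have "Q (A u) + Q (A w) = (cmod \<mu>)\<^sup>2 * (Q u + Q w)"
    unfolding u w Q_def cmod_power2
    by (simp add: matrix_vector_right_distrib matrix_vector_mult_diff_distrib matrix_vector_mult_scaleR
        inner_add_left inner_add_right inner_diff_left inner_diff_right)
       (simp add: algebra_simps power2_eq_square)
  then have "((cmod \<mu>)\<^sup>2 - t) * (Q u + Q w) = u \<bullet> u + w \<bullet> w"
    using eq[of u] eq[of w] by (simp add: algebra_simps)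
  also have "\<dots> > 0"
    using assms(4) by (metis add_nonneg_pos add_pos_nonneg inner_ge_zero inner_gt_zero_iff)
  finally have "Q u + Q w > 0"
    using t(2) by (simp add: zero_less_mult_iff)
  then have "Q u > 0 \<or> Q w > 0" by linarith
  then show ?thesis
    using that[OF t(1), of _ M] eq unfolding Q_def by blast
qed

subsection \<open>Trapped orbits in Euclidean space\<close>

text \<open>The mean value inequality is applied to \<open>f\<close> minus its linearisation at
  \<open>x\<close>. The derivative of this difference at \<open>p\<close> is
  \<open>D p - D x\<close>, which is small near \<open>x\<close> because \<open>f\<close> is
  C1.\<close>

lemma C1_strict_derivative:
  fixes f :: "'a::euclidean_space \<Rightarrow> 'b::real_normed_vector"
  assumes "open S" "Ck_on 1 S f" "x \<in> S" "0 < e"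
  obtains r where "0 < r" "ball x r \<subseteq> S"
    "\<And>y z. y \<in> ball x r \<Longrightarrow> z \<in> ball x r \<Longrightarrow>
      norm (f y - f z - frechet_derivative f (at x) (y - z)) \<le> e * norm (y - z)"
proof -
  define D where "D = (\<lambda>y. frechet_derivative f (at y))"
  have diff: "f differentiable (at y)" if "y \<in> S" for y
    using assms(2) that by auto
  have cont: "continuous_on S (\<lambda>y. D y v)" for v
    using assms(2) by (auto simp: D_def)
  have der: "(f has_derivative D y) (at y)" if "y \<in> S" for y
    unfolding D_def using diff[OF that] by (simp add: frechet_derivative_works)
  \<comment> \<open>\<open>Ck_on\<close> gives continuity of each directional derivative separately.
    Summing over the basis turns this into a bound on the operator norm of
    \<open>D y - D x\<close>.\<close>
  define F where "F = (\<lambda>y. \<Sum>i\<in>Basis. norm (D y i - D x i))"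
  have "continuous_on S F"
    unfolding F_def by (intro continuous_intros cont)
  then have "F \<midarrow>x\<rightarrow> F x"
    using assms(1,3) continuous_on_eq_continuous_at isCont_def by blast
  then have "eventually (\<lambda>y. F y < e) (at x)"
    using assms(4) by (intro order_tendstoD) (simp_all add: F_def)
  moreover have "eventually (\<lambda>y. y \<in> S) (at x)"
    using assms(1,3) eventually_at_topological by blast
  ultimately have "eventually (\<lambda>y. y \<in> S \<and> F y < e) (at x)"
    by eventually_elim simp
  then obtain r where r: "r > 0" "\<And>y. y \<noteq> x \<Longrightarrow> dist y x < r \<Longrightarrow> y \<in> S \<and> F y < e"
    unfolding eventually_at by blast
  have r': "y \<in> S \<and> F y < e" if "y \<in> ball x r" for y
    using that r(2)[of y] assms(3,4) by (cases "y = x") (auto simp: F_def dist_commute)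
  have lin: "linear (D y)" if "y \<in> S" for y
    using der[OF that] has_derivative_linear by blast
  have "norm ((f y - D x y) - (f z - D x z)) \<le> e * norm (y - z)"
    if "y \<in> ball x r" "z \<in> ball x r" for y z
  proof (rule differentiable_bound[OF convex_ball _ _ that])
    fix p assume p: "p \<in> ball x r"
    have "bounded_linear (D x)"
      using der[OF assms(3)] has_derivative_bounded_linear by blast
    then have "((\<lambda>y. f y - D x y) has_derivative (\<lambda>h. D p h - D x h)) (at p)"
      using p r' by (intro has_derivative_diff der bounded_linear_imp_has_derivative) auto
    then show "((\<lambda>y. f y - D x y) has_derivative (\<lambda>h. D p h - D x h)) (at p within ball x r)"
      by (rule has_derivative_at_withinI)
    have "norm (D p h - D x h) \<le> e * norm h" for h
    proof -
      have "D p h - D x h = (\<Sum>i\<in>Basis. (h \<bullet> i) *\<^sub>R (D p i - D x i))"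
        using lin[OF assms(3)] lin[of p] r'[OF p]
        by (subst (1 2) euclidean_representation[of h, symmetric])
           (simp add: linear_sum linear_cmul scaleR_diff_right sum_subtractf)
      also have "norm \<dots> \<le> (\<Sum>i\<in>Basis. norm h * norm (D p i - D x i))"
        by (rule sum_norm_le) (simp add: Basis_le_norm mult_right_mono)
      also have "\<dots> = norm h * F p"
        by (simp add: F_def sum_distrib_left)
      also have "\<dots> \<le> e * norm h"
        using r'[OF p] by (metis less_imp_le mult.commute mult_left_mono norm_ge_zero)
      finally show ?thesis .
    qed
    then show "onorm (\<lambda>h. D p h - D x h) \<le> e"
      by (rule onorm_le)
  qed
  moreover have "f y - f z - D x (y - z) = (f y - D x y) - (f z - D x z)" for y z
    using linear_diff[OF lin[OF assms(3)], of y z] by simp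
  ultimately have "norm (f y - f z - D x (y - z)) \<le> e * norm (y - z)"
    if "y \<in> ball x r" "z \<in> ball x r" for y z
    using that by metis
  then show ?thesis
    using that[of r] r(1) r' unfolding D_def by blast
qed

text \<open>Infinitely many disjoint translates of \<open>S\<close> fit into one ball. They all have
  the measure of \<open>S\<close>, which must then be zero.\<close>

lemma negligible_disjoint_translates:
  fixes S :: "'a::euclidean_space set"
  assumes "bounded S" "closed S"
    and disj: "\<And>x s. x \<in> S \<Longrightarrow> x + s *\<^sub>R v \<in> S \<Longrightarrow> s = 0"
  shows "negligible S"
proof -
  have lm: "S \<in> lmeasurable"
    using assms by (simp add: lmeasurable_compact compact_eq_bounded_closed)
  \<comment> \<open>The shifts are pairwise distinct, which gives disjointness, and at most 1, which
    keeps all translates in a common ball.\<close>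
  define V where "V = (\<lambda>k. (+) ((1 / real (Suc k)) *\<^sub>R v) ` S)"
  obtain b where b: "\<And>x. x \<in> S \<Longrightarrow> norm x \<le> b"
    using assms(1) bounded_iff by blast
  have sub: "V k \<subseteq> cball 0 (norm v + b)" for k
  proof
    fix y assume "y \<in> V k"
    then obtain x where x: "x \<in> S" "y = (1 / real (Suc k)) *\<^sub>R v + x"
      by (auto simp: V_def)
    have "norm ((1 / real (Suc k)) *\<^sub>R v) \<le> norm v"
      by (simp add: field_simps mult_left_le)
    then show "y \<in> cball 0 (norm v + b)"
      using b[OF x(1)] norm_triangle_ineq[of "(1 / real (Suc k)) *\<^sub>R v" x] x(2) by simp
  qed
  have Vm: "V k \<in> lmeasurable" for k
    by (simp add: V_def lm measurable_translation)
  have dj: "disjoint_family V"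
    unfolding disjoint_family_on_def
  proof (intro ballI impI equals0I)
    fix m n :: nat and x assume "m \<noteq> n" "x \<in> V m \<inter> V n"
    then obtain y z where yz: "y \<in> S" "z \<in> S"
      "(1 / real (Suc m)) *\<^sub>R v + y = (1 / real (Suc n)) *\<^sub>R v + z"
      by (auto simp: V_def)
    then have "z = y + (1 / real (Suc m) - 1 / real (Suc n)) *\<^sub>R v"
      unfolding scaleR_left_diff_distrib by (simp only: algebra_simps)
    then have "1 / real (Suc m) - 1 / real (Suc n) = 0"
      using disj yz by blast
    then show False using \<open>m \<noteq> n\<close> by simp
  qed
  have "of_nat n * measure lebesgue S \<le> measure lebesgue (cball (0::'a) (norm v + b))" for n :: nat
  proof -
    have "of_nat n * measure lebesgue S = (\<Sum>k<n. measure lebesgue (V k))"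
      by (simp add: V_def measure_translation)
    also have "\<dots> = measure lebesgue (\<Union>k<n. V k)"
      by (rule measure_UNION'[symmetric])
         (use Vm dj in \<open>auto simp: disjoint_family_on_def pairwise_def disjnt_def\<close>)
    also have "\<dots> \<le> measure lebesgue (cball (0::'a) (norm v + b))"
      using sub Vm by (intro measure_mono_fmeasurable) (auto intro!: sets.countable_UN'' fmeasurableD)
    finally show ?thesis .
  qed
  then have "measure lebesgue S \<le> 0"
    by (metis not_le reals_Archimedean3)
  then show ?thesis
    using lm by (simp add: negligible_iff_measure0 measure_le_0_iff)
qed

lemma negligible_trapped_near_unstable_point:
  fixes f :: "real^'n \<Rightarrow> real^'n::finite"
  assumes S: "open S" "Ck_on 1 S f" "p \<in> S"
    and u: "frechet_derivative f (at p) u = Re \<mu> *\<^sub>R u - Im \<mu> *\<^sub>R w"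
    and w: "frechet_derivative f (at p) w = Im \<mu> *\<^sub>R u + Re \<mu> *\<^sub>R w"
    and uw: "u \<noteq> 0 \<or> w \<noteq> 0" and \<mu>: "cmod \<mu> > 1"
  obtains r where "0 < r" "ball p r \<subseteq> S" "negligible {z. \<forall>k. (f ^^ k) z \<in> ball p r}"
proof -
  define A where "A = frechet_derivative f (at p)"
  have "f differentiable (at p)"
    using S(2,3) by simp
  then have A: "bounded_linear A"
    unfolding A_def frechet_derivative_works by (rule has_derivative_bounded_linear)
  obtain M :: "real^'n^'n" and t v where t: "t > 1" and v: "v \<bullet> (M *v v) > 0"
    and M: "\<And>x. A x \<bullet> (M *v A x) = t * (x \<bullet> (M *v x)) + x \<bullet> x"
    by (rule expanding_form[OF bounded_linear.linear[OF A] u[folded A_def] w[folded A_def] uw \<mu>], rule that, assumption+)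
  define Q where "Q = (\<lambda>x. x \<bullet> (M *v x))"
  obtain a where a: "a > 0" "\<And>x. norm (A x) \<le> norm x * a"
    using bounded_linear.pos_bounded[OF A] by blast
  obtain c where c: "c > 0" "\<And>x. norm (M *v x) \<le> norm x * c"
    using bounded_linear.pos_bounded[OF matrix_vector_mul_bounded_linear[of M]] by blast
  have inner: "\<bar>x \<bullet> (M *v y)\<bar> \<le> c * (norm x * norm y)" for x y
    by (rule order_trans[OF Cauchy_Schwarz_ineq2])
       (use mult_left_mono[OF c(2)[of y], of "norm x"] in \<open>simp add: mult_ac\<close>)
  \<comment> \<open>If \<open>f y - f z\<close> is \<open>A x + h\<close> with \<open>norm h\<close>
    at most \<open>\<delta> * norm x\<close>, then replacing \<open>A x\<close> by
    \<open>A x + h\<close> changes \<open>Q\<close> by at most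
    \<open>c * \<delta> * (2 * a + 1)\<close> times the square of \<open>norm x\<close>; here
    \<open>\<delta> \<le> 1\<close> handles the term quadratic in \<open>h\<close>. This choice lets
    the summand \<open>x \<bullet> x\<close> of the identity for \<open>Q (A x)\<close> absorb the
    error.\<close>
  define \<delta> where "\<delta> = min 1 (1 / (c * (2 * a + 1)))"
  have \<delta>: "0 < \<delta>" "\<delta> \<le> 1" "c * \<delta> * (2 * a + 1) \<le> 1"
  proof -
    show "0 < \<delta>" "\<delta> \<le> 1" using a(1) c(1) by (auto simp: \<delta>_def)
    have pos: "c * (2 * a + 1) > 0" using a(1) c(1) by simp
    have "\<delta> \<le> 1 / (c * (2 * a + 1))" by (simp add: \<delta>_def)
    then show "c * \<delta> * (2 * a + 1) \<le> 1"
      using pos by (simp add: pos_le_divide_eq mult_ac)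
  qed
  obtain r where r: "0 < r" "ball p r \<subseteq> S"
    and strict: "\<And>y z. y \<in> ball p r \<Longrightarrow> z \<in> ball p r \<Longrightarrow>
      norm (f y - f z - A (y - z)) \<le> \<delta> * norm (y - z)"
    using C1_strict_derivative[OF S \<delta>(1)] unfolding A_def by blast
  have step: "t * Q (y - z) \<le> Q (f y - f z)" if "y \<in> ball p r" "z \<in> ball p r" for y z
  proof -
    define x where "x = y - z"
    define h where "h = f y - f z - A x"
    define n where "n = norm x"
    have h: "norm h \<le> \<delta> * n"
      using strict[OF that] by (simp add: h_def x_def n_def)
    have Ax: "norm (A x) \<le> a * n"
      using a(2)[of x] by (simp add: n_def mult.commute)
    have n: "0 \<le> n" by (simp add: n_def)
    have "Q (f y - f z) = Q (A x + h)"
      by (simp add: h_def)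
    also have "\<dots> = Q (A x) + (A x \<bullet> (M *v h) + h \<bullet> (M *v A x) + h \<bullet> (M *v h))"
      by (simp add: Q_def matrix_vector_right_distrib inner_add_left inner_add_right)
    finally have eq: "Q (f y - f z) = t * Q x + n\<^sup>2 + (A x \<bullet> (M *v h) + h \<bullet> (M *v A x) + h \<bullet> (M *v h))"
      by (simp add: M Q_def n_def power2_norm_eq_inner)
    have 1: "norm (A x) * norm h \<le> (a * n) * (\<delta> * n)"
      using Ax h by (intro mult_mono) (use n a(1) in auto)
    have "norm h * norm h \<le> (\<delta> * n) * (\<delta> * n)"
      using h by (intro mult_mono) (use n \<delta>(1) in auto)
    also have "\<dots> \<le> (1 * n) * (\<delta> * n)"
      using \<delta>(1,2) n by (intro mult_right_mono) auto
    finally have 2: "norm h * norm h \<le> n * (\<delta> * n)" by simp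
    have "\<bar>A x \<bullet> (M *v h) + h \<bullet> (M *v A x) + h \<bullet> (M *v h)\<bar>
        \<le> c * (norm (A x) * norm h) + c * (norm h * norm (A x)) + c * (norm h * norm h)"
      using inner[of "A x" h] inner[of h "A x"] inner[of h h] by linarith
    also have "\<dots> = c * (2 * (norm (A x) * norm h) + norm h * norm h)"
      by (simp add: algebra_simps)
    also have "\<dots> \<le> c * (2 * ((a * n) * (\<delta> * n)) + n * (\<delta> * n))"
      using 1 2 c(1) by (intro mult_left_mono add_mono) auto
    also have "\<dots> = (c * \<delta> * (2 * a + 1)) * n\<^sup>2"
      by (simp add: algebra_simps power2_eq_square)
    also have "\<dots> \<le> 1 * n\<^sup>2"
      using \<delta>(3) by (rule mult_right_mono) simp
    finally show ?thesis
      unfolding eq x_def[symmetric] by linarith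
  qed
  define W where "W = {z. \<forall>k. (f ^^ k) z \<in> ball p r}"
  have neg: "Q (y - z) \<le> 0" if "y \<in> W" "z \<in> W" for y z
  proof (rule ccontr)
    \<comment> \<open>A positive value would be multiplied by at least \<open>t > 1\<close> at every
      step, while \<open>Q\<close> is bounded on differences of points of the ball.\<close>
    assume "\<not> Q (y - z) \<le> 0"
    then have pos: "0 < Q (y - z)" by simp
    have grow: "t ^ k * Q (y - z) \<le> Q ((f ^^ k) y - (f ^^ k) z)" for k
    proof (induction k)
      case (Suc k)
      have "t * (t ^ k * Q (y - z)) \<le> t * Q ((f ^^ k) y - (f ^^ k) z)"
        using Suc t by simp
      also have "\<dots> \<le> Q ((f ^^ Suc k) y - (f ^^ Suc k) z)"
        using step[of "(f ^^ k) y" "(f ^^ k) z"] that unfolding W_def by simp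
      finally show ?case by (simp add: mult_ac)
    qed simp
    have bound: "Q ((f ^^ k) y - (f ^^ k) z) \<le> c * ((2 * r) * (2 * r))" for k
    proof -
      have "dist p ((f ^^ k) y) < r" "dist p ((f ^^ k) z) < r"
        using that unfolding W_def by (simp_all only: mem_Collect_eq mem_ball)
      then have "dist ((f ^^ k) y) ((f ^^ k) z) \<le> 2 * r"
        using dist_triangle3[of "(f ^^ k) y" "(f ^^ k) z" p] by linarith
      then have "norm ((f ^^ k) y - (f ^^ k) z) \<le> 2 * r" by (simp only: dist_norm)
      then have "c * (norm ((f ^^ k) y - (f ^^ k) z) * norm ((f ^^ k) y - (f ^^ k) z)) \<le> c * ((2 * r) * (2 * r))"
        using c(1) r(1) by (intro mult_left_mono mult_mono) auto
      then show ?thesis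
        using inner[of "(f ^^ k) y - (f ^^ k) z" "(f ^^ k) y - (f ^^ k) z"] unfolding Q_def by linarith
    qed
    obtain k where "c * ((2 * r) * (2 * r)) / Q (y - z) < t ^ k"
      using real_arch_pow[OF t] by blast
    then have "c * ((2 * r) * (2 * r)) < t ^ k * Q (y - z)"
      using pos by (simp add: pos_divide_less_eq)
    then show False using grow[of k] bound[of k] by linarith
  qed
  \<comment> \<open>\<open>W\<close> need not be closed, but the inequality is a closed condition on
    pairs, so it passes to the closure, a compact set to which the translation argument
    applies.\<close>
  have contQ: "continuous_on UNIV (\<lambda>q. Q (fst q - snd q))"
    unfolding Q_def
    by (intro continuous_intros bounded_linear.continuous_on[OF matrix_vector_mul_bounded_linear])
  have "closed {q. Q (fst q - snd q) \<le> 0}"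
    by (intro closed_Collect_le contQ continuous_on_const)
  moreover have "W \<times> W \<subseteq> {q. Q (fst q - snd q) \<le> 0}"
    using neg by auto
  ultimately have "closure W \<times> closure W \<subseteq> {q. Q (fst q - snd q) \<le> 0}"
    unfolding closure_Times[symmetric] by (rule closure_minimal[rotated])
  then have neg': "Q (y - z) \<le> 0" if "y \<in> closure W" "z \<in> closure W" for y z
    using that by auto
  have "negligible (closure W)"
  proof (rule negligible_disjoint_translates)
    have "W \<subseteq> ball p r"
      unfolding W_def by (auto dest: spec[of _ 0])
    then show "bounded (closure W)"
      using bounded_subset[OF bounded_ball] bounded_closure by blast
    fix x s assume "x \<in> closure W" "x + s *\<^sub>R v \<in> closure W"
    then have "Q (s *\<^sub>R v) \<le> 0"
      using neg'[of "x + s *\<^sub>R v" x] by simp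
    then have "s * s * Q v \<le> 0"
      by (simp add: Q_def matrix_vector_mult_scaleR mult_ac)
    then show "s = 0"
      using v by (auto simp: Q_def mult_le_0_iff)
  qed simp
  then have "negligible W"
    by (rule negligible_subset[OF _ closure_subset])
  then show ?thesis
    unfolding W_def by (rule that[OF r])
qed

subsection \<open>Charts, tangent spaces and null sets\<close>

lemma is_chart_inj_on:
  assumes "is_chart X c"
  shows "inj_on (snd c) (fst c)"
proof -
  have "openin X (fst c)"
    and h: "homeomorphic_map (subtopology X (fst c)) (top_of_set (snd c ` fst c)) (snd c)"
    using assms by (simp_all only: is_chart_def)
  then have "topspace (subtopology X (fst c)) = fst c"
    by (intro topspace_subtopology_subset openin_subset)
  moreover have "inj_on (snd c) (topspace (subtopology X (fst c)))"
    by (rule homeomorphic_imp_injective_map[OF h])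
  ultimately show ?thesis by (simp only:)
qed

lemma is_chart_inv: "is_chart X c \<Longrightarrow> x \<in> fst c \<Longrightarrow> inv_into (fst c) (snd c) (snd c x) = x"
  by (rule inv_into_f_f[OF is_chart_inj_on])

lemma is_chart_open_image:
  assumes "is_chart X c" "openin X U" "U \<subseteq> fst c"
  shows "open (snd c ` U)"
proof -
  have "open_map (subtopology X (fst c)) (top_of_set (snd c ` fst c)) (snd c)"
    using assms(1) homeomorphic_imp_open_map unfolding is_chart_def by blast
  moreover have "openin (subtopology X (fst c)) U"
    using assms(2,3) by (metis inf.absorb1 openin_subtopology)
  ultimately have "openin (top_of_set (snd c ` fst c)) (snd c ` U)"
    by (simp add: open_map_def)
  then show ?thesis
    using assms(1) openin_open_trans unfolding is_chart_def by blast
qed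

lemma is_chart_open_vimage:
  assumes "is_chart X c" "open B"
  shows "openin X {x \<in> fst c. snd c x \<in> B}"
proof -
  have c: "openin X (fst c)" "continuous_map (subtopology X (fst c)) euclidean (snd c)"
    using assms(1) homeomorphic_imp_continuous_map[of _ _ "snd c"] continuous_map_into_fulltopology
    unfolding is_chart_def by blast+
  have "openin (subtopology X (fst c)) {x \<in> topspace (subtopology X (fst c)). snd c x \<in> B}"
    using openin_continuous_map_preimage[OF c(2)] assms(2) by auto
  then have "openin X {x \<in> topspace (subtopology X (fst c)). snd c x \<in> B}"
    using c(1) openin_trans_full by blast
  then show ?thesis
    by (simp only: topspace_subtopology_subset[OF openin_subset[OF c(1)]])
qed

lemma smooth_manifold_chart: "smooth_manifold X \<A> \<Longrightarrow> c \<in> \<A> \<Longrightarrow> is_chart X c"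
  unfolding smooth_manifold_def by (elim conjE bspec)

lemma smooth_manifold_ex_chart:
  "smooth_manifold X \<A> \<Longrightarrow> x \<in> topspace X \<Longrightarrow> \<exists>c. c \<in> charts_at \<A> x"
  unfolding smooth_manifold_def charts_at_def by (elim conjE) (metis (no_types, lifting) UN_E mem_Collect_eq)

lemma local_rep_apply:
  assumes "smooth_manifold X \<A>" "c \<in> \<A>" "x \<in> fst c"
  shows "local_rep c d g (snd c x) = snd d (g x)"
  using is_chart_inv[OF smooth_manifold_chart[OF assms(1,2)] assms(3)] by (simp add: local_rep_def)

lemma transition_differentiable:
  assumes "smooth_manifold X \<A>" "c \<in> \<A>" "d \<in> \<A>" "x \<in> fst c" "x \<in> fst d"
  shows "local_rep c d id differentiable (at (snd c x))"
proof -
  have "smooth_on (snd c ` (fst c \<inter> fst d)) (local_rep c d id)"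
    using assms unfolding smooth_manifold_def compatible_def by blast
  then have "Ck_on (Suc 0) (snd c ` (fst c \<inter> fst d)) (local_rep c d id)"
    unfolding smooth_on_def by blast
  then show ?thesis using assms(4,5) by simp
qed

lemma transition_has_derivative:
  assumes "smooth_manifold X \<A>" "c \<in> charts_at \<A> x" "d \<in> charts_at \<A> x"
  shows "(local_rep c d id has_derivative frechet_derivative (local_rep c d id) (at (snd c x))) (at (snd c x))"
  unfolding frechet_derivative_works[symmetric]
  using transition_differentiable[OF assms(1), of c d x] assms(2,3) by (simp add: charts_at_def)

text \<open>This is the chain rule for transition maps: going from \<open>c\<close> to
  \<open>e\<close> through \<open>d\<close> agrees with going directly on the image of
  \<open>fst c \<inter> fst d\<close>, an open set around \<open>snd c x\<close>, and derivatives
  are local.\<close>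

lemma transition_cocycle:
  assumes M: "smooth_manifold X \<A>" and c: "c \<in> charts_at \<A> x" and d: "d \<in> charts_at \<A> x"
    and e: "e \<in> charts_at \<A> x"
  shows "frechet_derivative (local_rep d e id) (at (snd d x))
      (frechet_derivative (local_rep c d id) (at (snd c x)) v) =
    frechet_derivative (local_rep c e id) (at (snd c x)) v"
proof -
  have cd: "c \<in> \<A>" "x \<in> fst c" "d \<in> \<A>" "x \<in> fst d"
    using c d by (auto simp: charts_at_def)
  have op: "openin X (fst c \<inter> fst d)"
    using smooth_manifold_chart[OF M] cd unfolding is_chart_def by blast
  have "(local_rep d e id has_derivative frechet_derivative (local_rep d e id) (at (snd d x)))
      (at (local_rep c d id (snd c x)))"
    using transition_has_derivative[OF M d e] local_rep_apply[OF M cd(1,2), of d id] by simp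
  from has_derivative_compose[OF transition_has_derivative[OF M c d] this]
  have "((\<lambda>z. local_rep d e id (local_rep c d id z)) has_derivative
      (\<lambda>v. frechet_derivative (local_rep d e id) (at (snd d x))
        (frechet_derivative (local_rep c d id) (at (snd c x)) v))) (at (snd c x))" .
  then have "(local_rep c e id has_derivative
      (\<lambda>v. frechet_derivative (local_rep d e id) (at (snd d x))
        (frechet_derivative (local_rep c d id) (at (snd c x)) v))) (at (snd c x))"
  proof (rule has_derivative_transform_within_open)
    show "open (snd c ` (fst c \<inter> fst d))"
      using is_chart_open_image[OF smooth_manifold_chart[OF M cd(1)] op] by simp
    show "snd c x \<in> snd c ` (fst c \<inter> fst d)" using cd by simp
    fix z assume "z \<in> snd c ` (fst c \<inter> fst d)"
    then obtain y where "y \<in> fst c" "y \<in> fst d" "z = snd c y" by blast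
    then show "local_rep d e id (local_rep c d id z) = local_rep c e id z"
      by (simp add: local_rep_apply[OF M cd(1)] local_rep_apply[OF M cd(3)])
  qed
  from frechet_derivative_at[OF this] show ?thesis by metis
qed

lemma transition_derivative_self:
  assumes M: "smooth_manifold X \<A>" and c: "c \<in> charts_at \<A> x"
  shows "frechet_derivative (local_rep c c id) (at (snd c x)) v = v"
proof -
  have c: "c \<in> \<A>" "x \<in> fst c" "is_chart X c"
    using c smooth_manifold_chart[OF M] by (auto simp: charts_at_def)
  have "((\<lambda>z. z) has_derivative (\<lambda>v. v)) (at (snd c x))" by simp
  then have "(local_rep c c id has_derivative (\<lambda>v. v)) (at (snd c x))"
  proof (rule has_derivative_transform_within_open)
    show "open (snd c ` fst c)" using c(3) by (simp add: is_chart_def)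
    show "snd c x \<in> snd c ` fst c" using c(2) by simp
    fix z assume "z \<in> snd c ` fst c"
    then show "z = local_rep c c id z"
      using local_rep_apply[OF M c(1), of _ c id] by fastforce
  qed
  from frechet_derivative_at[OF this] show ?thesis by metis
qed

text \<open>Together with \<open>tangent_space_ex\<close> this makes evaluation at a single chart a
  bijection from the tangent space onto the coordinate space, so statements about the differential
  reduce to statements about one local representative.\<close>

lemma tangent_space_eqI:
  assumes "u \<in> tangent_space \<A> x" "v \<in> tangent_space \<A> x" "c \<in> charts_at \<A> x" "u c = v c"
  shows "u = v"
proof
  fix d show "u d = v d"
  proof (cases "d \<in> charts_at \<A> x")
    case True
    then have "u d = frechet_derivative (local_rep c d id) (at (snd c x)) (u c)"
      "v d = frechet_derivative (local_rep c d id) (at (snd c x)) (v c)"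
      using assms unfolding tangent_space_def by blast+
    then show ?thesis using assms(4) by simp
  next
    case False
    then have "u d = 0" "v d = 0"
      using assms unfolding tangent_space_def by blast+
    then show ?thesis by simp
  qed
qed

text \<open>The vector \<open>w\<close> is transported from \<open>c\<close> to all other charts
  around \<open>x\<close>; the cocycle identity makes the resulting family a tangent vector.\<close>

lemma tangent_space_ex:
  assumes M: "smooth_manifold X \<A>" and c: "c \<in> charts_at \<A> x"
  shows "\<exists>v\<in>tangent_space \<A> x. v c = w"
proof
  let ?v = "\<lambda>d. if d \<in> charts_at \<A> x then frechet_derivative (local_rep c d id) (at (snd c x)) w else 0"
  show "?v \<in> tangent_space \<A> x"
    using transition_cocycle[OF M c] by (simp add: tangent_space_def)
  show "?v c = w"
    using transition_derivative_self[OF M c] c by simp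
qed

text \<open>By the Lindelof property countably many of the neighbourhoods cover \<open>S\<close>. On
  each of them a transition map carries the null image in the chart \<open>c\<close> to the image in
  any other chart \<open>d\<close>, and differentiable maps between spaces of equal dimension
  preserve null sets.\<close>

lemma measure_zeroI_local:
  fixes X :: "'a topology" and \<A> :: "('a, 'n::finite) chart set"
  assumes M: "smooth_manifold X \<A>" and S: "S \<subseteq> topspace X"
    and loc: "\<And>x. x \<in> S \<Longrightarrow>
      \<exists>N c. openin X N \<and> x \<in> N \<and> c \<in> \<A> \<and> N \<subseteq> fst c \<and> negligible (snd c ` (S \<inter> N))"
  shows "measure_zero X \<A> S"
proof -
  define \<U> where "\<U> = {N. openin X N \<and> (\<exists>c\<in>\<A>. N \<subseteq> fst c \<and> negligible (snd c ` (S \<inter> N)))}"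
  have "second_countable X"
    using M unfolding smooth_manifold_def by blast
  then have "Lindelof_space (subtopology X S)"
    by (intro second_countable_imp_Lindelof_space second_countable_subtopology)
  moreover have "\<forall>U\<in>\<U>. openin X U"
    unfolding \<U>_def by blast
  moreover have "S \<subseteq> \<Union>\<U>"
  proof
    fix x assume "x \<in> S"
    from loc[OF this] show "x \<in> \<Union>\<U>"
      unfolding \<U>_def by blast
  qed
  ultimately obtain \<V> where \<V>: "countable \<V>" "\<V> \<subseteq> \<U>" "S \<subseteq> \<Union>\<V>"
    using Lindelof_space_subtopology_subset[OF S] by metis
  have "negligible (snd d ` (S \<inter> fst d))" if d: "d \<in> \<A>" for d
  proof -
    have "negligible (snd d ` (S \<inter> N \<inter> fst d))" if N: "N \<in> \<V>" for N
    proof -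
      obtain c where c: "c \<in> \<A>" "N \<subseteq> fst c" "negligible (snd c ` (S \<inter> N))"
        using N \<V>(2) unfolding \<U>_def by blast
      have "local_rep c d id differentiable_on (snd c ` (S \<inter> N \<inter> fst d))"
        unfolding differentiable_on_def
        using transition_differentiable[OF M c(1) d] c(2) differentiable_at_withinI by blast
      moreover have "negligible (snd c ` (S \<inter> N \<inter> fst d))"
        by (rule negligible_subset[OF c(3)]) auto
      ultimately have "negligible (local_rep c d id ` snd c ` (S \<inter> N \<inter> fst d))"
        using negligible_differentiable_image_negligible by blast
      moreover have "local_rep c d id ` snd c ` (S \<inter> N \<inter> fst d) = snd d ` (S \<inter> N \<inter> fst d)"
        unfolding image_image
        by (intro image_cong) (use c(2) in \<open>auto simp: local_rep_apply[OF M c(1)]\<close>)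
      ultimately show ?thesis by simp
    qed
    then have "negligible (\<Union>N\<in>\<V>. snd d ` (S \<inter> N \<inter> fst d))"
      using \<V>(1) by (intro negligible_countable_Union) auto
    then show ?thesis
      by (rule negligible_subset) (use \<V>(3) in blast)
  qed
  then show ?thesis
    using S by (simp add: measure_zero_def negligible_iff_null_sets)
qed

lemma measure_zero_subset:
  assumes "measure_zero X \<A> T" "S \<subseteq> T"
  shows "measure_zero X \<A> S"
  unfolding measure_zero_def
proof (intro conjI ballI)
  show "S \<subseteq> topspace X"
    using assms unfolding measure_zero_def by blast
  fix c assume "c \<in> \<A>"
  then have "negligible (snd c ` (T \<inter> fst c))"
    using assms(1) by (simp add: measure_zero_def negligible_iff_null_sets)
  then show "snd c ` (S \<inter> fst c) \<in> null_sets lebesgue"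
    unfolding negligible_iff_null_sets[symmetric]
    by (rule negligible_subset) (use assms(2) in blast)
qed

lemma measure_zero_countable_Union:
  assumes "countable I" "\<And>i. i \<in> I \<Longrightarrow> measure_zero X \<A> (S i)"
  shows "measure_zero X \<A> (\<Union>i\<in>I. S i)"
  unfolding measure_zero_def negligible_iff_null_sets[symmetric]
proof (intro conjI ballI)
  show "(\<Union>i\<in>I. S i) \<subseteq> topspace X"
    using assms(2) by (auto simp: measure_zero_def)
  fix c assume "c \<in> \<A>"
  then have "negligible (\<Union>i\<in>I. snd c ` (S i \<inter> fst c))"
    using assms by (intro negligible_countable_Union) (auto simp: measure_zero_def negligible_iff_null_sets)
  then show "negligible (snd c ` ((\<Union>i\<in>I. S i) \<inter> fst c))"
    by (rule negligible_subset) blast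
qed

lemma negligible_if_expanding_image:
  fixes f :: "'a::euclidean_space \<Rightarrow> 'b::euclidean_space"
  assumes "DIM('b) \<le> DIM('a)" "negligible (f ` V)" "0 < b"
    and lower: "\<And>y z. y \<in> V \<Longrightarrow> z \<in> V \<Longrightarrow> b * norm (y - z) \<le> norm (f y - f z)"
  shows "negligible V"
proof -
  have inj: "inj_on f V"
  proof (rule inj_onI)
    fix y z assume "y \<in> V" "z \<in> V" "f y = f z"
    with lower[of y z] have "b * norm (y - z) \<le> 0" by simp
    with \<open>0 < b\<close> show "y = z" by (simp add: mult_le_0_iff)
  qed
  have "negligible (inv_into V f ` (f ` V))"
  proof (rule negligible_locally_Lipschitz_image[OF assms(1,2)])
    fix q assume q: "q \<in> f ` V"
    have "norm (inv_into V f s - inv_into V f q) \<le> (1 / b) * norm (s - q)" if "s \<in> f ` V" for s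
      using lower[of "inv_into V f s" "inv_into V f q"] that q \<open>0 < b\<close>
      by (simp add: inv_into_into f_inv_into_f pos_le_divide_eq mult.commute)
    then show "\<exists>T B. open T \<and> q \<in> T \<and>
        (\<forall>s\<in>f ` V \<inter> T. norm (inv_into V f s - inv_into V f q) \<le> B * norm (s - q))"
      by (intro exI[of _ UNIV] exI[of _ "1 / b"]) auto
  qed
  then show ?thesis
    using inj by (simp add: image_inv_into_cancel inv_into_image_cancel)
qed

subsection \<open>Preimages of null sets and trapped orbits on the manifold\<close>

text \<open>The chart \<open>c\<close> is the one selected inside \<open>differential\<close>, so
  the matrix of the differential is read off directly, with no change of chart at the
  source.\<close>

lemma invertible_differential_inj:
  assumes M: "smooth_manifold X \<A>" and inv: "invertible_differential \<A> \<B> g x"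
    and x: "x \<in> topspace X" and d: "d \<in> charts_at \<B> (g x)" and c: "c = (SOME c. c \<in> charts_at \<A> x)"
  shows "inj (frechet_derivative (local_rep c d g) (at (snd c x)))"
proof (rule injI)
  let ?D = "frechet_derivative (local_rep c d g) (at (snd c x))"
  fix w1 w2 assume eq: "?D w1 = ?D w2"
  have cA: "c \<in> charts_at \<A> x"
    unfolding c by (rule someI_ex[OF smooth_manifold_ex_chart[OF M x]])
  obtain v1 v2 where v: "v1 \<in> tangent_space \<A> x" "v1 c = w1" "v2 \<in> tangent_space \<A> x" "v2 c = w2"
    using tangent_space_ex[OF M cA] by metis
  have bij: "bij_betw (differential \<A> \<B> g x) (tangent_space \<A> x) (tangent_space \<B> (g x))"
    using inv by (simp only: invertible_differential_def)
  have "differential \<A> \<B> g x v d = ?D (v c)" for v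
    using d by (simp add: differential_def c[symmetric] Let_def)
  then have "differential \<A> \<B> g x v1 d = differential \<A> \<B> g x v2 d"
    using eq v by simp
  then have "differential \<A> \<B> g x v1 = differential \<A> \<B> g x v2"
    using tangent_space_eqI[OF bij_betw_apply[OF bij v(1)] bij_betw_apply[OF bij v(3)] d] by blast
  then have "v1 = v2"
    using bij_betw_imp_inj_on[OF bij] v by (meson inj_onD)
  then show "w1 = w2" using v by simp
qed

lemma C1_map_local:
  assumes M: "smooth_manifold X \<A>" and N: "smooth_manifold Y \<B>" and g: "C1_map X \<A> Y \<B> g"
    and c: "c \<in> \<A>" and d: "d \<in> \<B>"
  shows "openin X (fst c \<inter> g -` fst d)" "open (snd c ` (fst c \<inter> g -` fst d))"
    "Ck_on 1 (snd c ` (fst c \<inter> g -` fst d)) (local_rep c d g)"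
proof -
  have ch: "is_chart X c" "openin X (fst c)" "openin Y (fst d)"
    using smooth_manifold_chart[OF M c] smooth_manifold_chart[OF N d] by (simp_all add: is_chart_def)
  have "continuous_map X Y g"
    using g by (simp only: C1_map_def)
  then have "openin X (fst c \<inter> {x \<in> topspace X. g x \<in> fst d})"
    by (intro openin_Int ch(2) openin_continuous_map_preimage[OF _ ch(3)])
  moreover have "fst c \<inter> {x \<in> topspace X. g x \<in> fst d} = fst c \<inter> g -` fst d"
    using openin_subset[OF ch(2)] by blast
  ultimately show op: "openin X (fst c \<inter> g -` fst d)" by (simp only:)
  show "open (snd c ` (fst c \<inter> g -` fst d))"
    by (rule is_chart_open_image[OF ch(1) op]) simp
  show "Ck_on 1 (snd c ` (fst c \<inter> g -` fst d)) (local_rep c d g)"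
    using g c d unfolding C1_map_def by blast
qed

text \<open>Near a point with invertible differential the local representative expands distances by
  a positive factor, so a null image has a null preimage there. The remaining points form a null set
  by assumption.\<close>

lemma measure_zero_vimage:
  fixes X :: "'a topology" and \<A> :: "('a, 'n::finite) chart set"
    and Y :: "'b topology" and \<B> :: "('b, 'n) chart set"
  assumes M: "smooth_manifold X \<A>" and N: "smooth_manifold Y \<B>" and g: "C1_map X \<A> Y \<B> g"
    and inv: "almost_all X \<A> (invertible_differential \<A> \<B> g)" and S: "measure_zero Y \<B> S"
  shows "measure_zero X \<A> {x \<in> topspace X. g x \<in> S}"
proof -
  define T where "T = {x \<in> topspace X. invertible_differential \<A> \<B> g x \<and> g x \<in> S}"
  have "measure_zero X \<A> T"
  proof (rule measure_zeroI_local[OF M])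
    show "T \<subseteq> topspace X" by (auto simp: T_def)
    fix x assume "x \<in> T"
    then have x: "x \<in> topspace X" "invertible_differential \<A> \<B> g x" "g x \<in> S"
      by (simp_all add: T_def)
    define c where "c = (SOME c. c \<in> charts_at \<A> x)"
    have c: "c \<in> \<A>" "x \<in> fst c"
      using someI_ex[OF smooth_manifold_ex_chart[OF M x(1)]] by (simp_all add: c_def charts_at_def)
    have "g x \<in> topspace Y"
      using S x(3) by (auto simp: measure_zero_def)
    then obtain d where d': "d \<in> charts_at \<B> (g x)"
      using smooth_manifold_ex_chart[OF N] by blast
    then have d: "d \<in> \<B>" "g x \<in> fst d" by (simp_all add: charts_at_def)
    define f where "f = local_rep c d g"
    define G where "G = fst c \<inter> g -` fst d"
    note loc = C1_map_local[OF M N g c(1) d(1), folded f_def G_def]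
    have xG: "x \<in> G" using c d by (simp add: G_def)
    then have p: "snd c x \<in> snd c ` G" by simp
    define D where "D = frechet_derivative f (at (snd c x))"
    have "f differentiable (at (snd c x))"
      using loc(3) xG by simp
    then have "linear D"
      unfolding D_def frechet_derivative_works by (rule has_derivative_linear)
    moreover have "inj D"
      unfolding D_def f_def by (rule invertible_differential_inj[OF M x(2,1) d' c_def])
    ultimately obtain b where b: "b > 0" "\<And>v. b * norm v \<le> norm (D v)"
      by (rule linear_inj_bounded_below_pos) blast
    \<comment> \<open>The linear part stretches by at least \<open>b\<close>; an error of at most
      \<open>b / 2\<close> leaves a lower bound of \<open>b / 2\<close> for \<open>f\<close>
      itself.\<close>
    have "0 < b / 2" using b(1) by simp
    from C1_strict_derivative[OF loc(2,3) p this]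
    obtain r where r: "0 < r" and strict: "\<And>y z. y \<in> ball (snd c x) r \<Longrightarrow> z \<in> ball (snd c x) r \<Longrightarrow>
        norm (f y - f z - D (y - z)) \<le> b / 2 * norm (y - z)"
      unfolding D_def by metis
    have lower: "b / 2 * norm (y - z) \<le> norm (f y - f z)"
      if "y \<in> ball (snd c x) r" "z \<in> ball (snd c x) r" for y z
      using strict[OF that] b(2)[of "y - z"] norm_triangle_ineq2[of "D (y - z)" "D (y - z) - (f y - f z)"]
      by (simp add: norm_minus_commute field_simps)
    define U where "U = G \<inter> {y \<in> fst c. snd c y \<in> ball (snd c x) r}"
    define V where "V = snd c ` (T \<inter> U)"
    have "f ` V \<subseteq> snd d ` (S \<inter> fst d)"
      by (auto simp: V_def U_def G_def T_def f_def local_rep_apply[OF M c(1)])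
    moreover have "negligible (snd d ` (S \<inter> fst d))"
      using S d(1) by (simp add: measure_zero_def negligible_iff_null_sets)
    ultimately have "negligible (f ` V)"
      using negligible_subset by blast
    then have "negligible V"
    proof (rule negligible_if_expanding_image[OF order_refl, of _ _ "b / 2"])
      fix y z assume "y \<in> V" "z \<in> V"
      then show "b / 2 * norm (y - z) \<le> norm (f y - f z)"
        by (intro lower) (auto simp: V_def U_def)
    qed (use b in simp)
    moreover have "openin X U"
      unfolding U_def
      by (intro openin_Int loc(1) is_chart_open_vimage[OF smooth_manifold_chart[OF M c(1)]] open_ball)
    moreover have "x \<in> U" "U \<subseteq> fst c"
      using xG c r by (auto simp: U_def)
    ultimately show "\<exists>N c. openin X N \<and> x \<in> N \<and> c \<in> \<A> \<and> N \<subseteq> fst c \<and> negligible (snd c ` (T \<inter> N))"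
      using c(1) unfolding V_def by blast
  qed
  moreover have "measure_zero X \<A> {x \<in> topspace X. \<not> invertible_differential \<A> \<B> g x}"
    using inv by (simp only: almost_all_def)
  ultimately have "measure_zero X \<A> (\<Union>S\<in>{T, {x \<in> topspace X. \<not> invertible_differential \<A> \<B> g x}}. S)"
    by (intro measure_zero_countable_Union) auto
  then show ?thesis
    by (rule measure_zero_subset) (auto simp: T_def)
qed

lemma measure_zero_funpow_vimage:
  fixes X :: "'a topology" and \<A> :: "('a, 'n::finite) chart set"
  assumes M: "smooth_manifold X \<A>" and g: "C1_map X \<A> X \<A> g"
    and inv: "almost_all X \<A> (invertible_differential \<A> \<A> g)" and S: "measure_zero X \<A> S"
  shows "measure_zero X \<A> {x \<in> topspace X. (g ^^ k) x \<in> S}"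
proof (induction k)
  case 0
  then show ?case
    by (rule measure_zero_subset[OF S, of "{x \<in> topspace X. (g ^^ 0) x \<in> S}"]) auto
next
  case (Suc k)
  have "g x \<in> topspace X" if "x \<in> topspace X" for x
    using g that unfolding C1_map_def by (blast dest: continuous_map_image_subset_topspace)
  then show ?case
    by (intro measure_zero_subset[OF measure_zero_vimage[OF M M g inv Suc]])
       (auto simp: funpow_swap1)
qed

text \<open>The limit points may be uncountable in number, but countably many of their trapping
  neighbourhoods suffice. A converging orbit eventually stays in one of them, so its initial point
  lies in the preimage of a null trapped set under some iterate.\<close>

lemma measure_zero_orbits_converging:
  fixes X :: "'a topology" and \<A> :: "('a, 'n::finite) chart set"
  assumes "smooth_manifold X \<A>" and "C1_map X \<A> X \<A> g"
    and "almost_all X \<A> (invertible_differential \<A> \<A> g)"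
    and trapped: "\<And>x. P x \<Longrightarrow> \<exists>N. openin X N \<and> x \<in> N \<and> measure_zero X \<A> {y. \<forall>k. (g ^^ k) y \<in> N}"
  shows "measure_zero X \<A>
    {x0 \<in> topspace X. \<exists>x. P x \<and> limitin X (\<lambda>t. (g ^^ t) x0) x sequentially}"
proof -
  define W where "W = (\<lambda>N. {y. \<forall>k. (g ^^ k) y \<in> N})"
  define F where "F = {x. P x}"
  define \<U> where "\<U> = {N. openin X N \<and> measure_zero X \<A> (W N)}"
  have F: "F \<subseteq> topspace X"
    unfolding F_def using trapped openin_subset by blast
  have "second_countable X"
    using assms(1) by (simp only: smooth_manifold_def)
  then have "Lindelof_space (subtopology X F)"
    by (intro second_countable_imp_Lindelof_space second_countable_subtopology)
  moreover have "\<forall>U\<in>\<U>. openin X U"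
    by (simp add: \<U>_def)
  moreover have "F \<subseteq> \<Union>\<U>"
    using trapped by (fastforce simp: F_def \<U>_def W_def)
  ultimately obtain \<V> where \<V>: "countable \<V>" "\<V> \<subseteq> \<U>" "F \<subseteq> \<Union>\<V>"
    using Lindelof_space_subtopology_subset[OF F] by metis
  have "measure_zero X \<A> (\<Union>(N, T)\<in>\<V> \<times> UNIV. {x0 \<in> topspace X. (g ^^ T) x0 \<in> W N})"
  proof (rule measure_zero_countable_Union)
    show "countable (\<V> \<times> (UNIV :: nat set))" using \<V>(1) by simp
    fix i assume "i \<in> \<V> \<times> (UNIV :: nat set)"
    then have "measure_zero X \<A> (W (fst i))"
      using \<V>(2) by (auto simp: \<U>_def)
    from measure_zero_funpow_vimage[OF assms(1-3) this, of "snd i"]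
    show "measure_zero X \<A> (case i of (N, T) \<Rightarrow> {x0 \<in> topspace X. (g ^^ T) x0 \<in> W N})"
      by (simp add: case_prod_beta)
  qed
  then show ?thesis
  proof (rule measure_zero_subset, safe)
    fix x0 x assume x0: "x0 \<in> topspace X" and x: "P x"
      and lim: "limitin X (\<lambda>t. (g ^^ t) x0) x sequentially"
    obtain N where N: "N \<in> \<V>" "x \<in> N"
      using x \<V>(3) by (auto simp: F_def)
    then have "openin X N" using \<V>(2) by (auto simp: \<U>_def)
    then obtain T where "\<And>t. t \<ge> T \<Longrightarrow> (g ^^ t) x0 \<in> N"
      using lim N(2) by (auto simp: limitin_sequentially)
    then have "(g ^^ T) x0 \<in> W N"
      by (simp add: W_def flip: funpow_add[THEN fun_cong, unfolded o_apply])
    then show "x0 \<in> (\<Union>(N, T)\<in>\<V> \<times> UNIV. {x0 \<in> topspace X. (g ^^ T) x0 \<in> W N})"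
      using N(1) x0 by auto
  qed
qed

text \<open>In a chart, an orbit of \<open>g\<close> that stays in \<open>N\<close> becomes an orbit
  of the local representative that stays in a small ball, and the Euclidean result applies.\<close>

lemma unstable_fixed_point_trapped:
  fixes X :: "'a topology" and \<A> :: "('a, 'n::finite) chart set"
  assumes M: "smooth_manifold X \<A>" and g: "C1_map X \<A> X \<A> g" and x: "unstable_fixed_point X \<A> g x"
  shows "\<exists>N. openin X N \<and> x \<in> N \<and> measure_zero X \<A> {y. \<forall>k. (g ^^ k) y \<in> N}"
proof -
  obtain \<mu> where x: "x \<in> topspace X" "g x = x" and "differential_eigenvalue \<A> g x \<mu>" and \<mu>: "cmod \<mu> > 1"
    using x unfolding unstable_fixed_point_def by blast
  then obtain u w where u: "u \<in> tangent_space \<A> x" and w: "w \<in> tangent_space \<A> x"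
    and uw: "\<not> (u = (\<lambda>_. 0) \<and> w = (\<lambda>_. 0))"
    and Du: "differential \<A> \<A> g x u = (\<lambda>c. Re \<mu> *\<^sub>R u c - Im \<mu> *\<^sub>R w c)"
    and Dw: "differential \<A> \<A> g x w = (\<lambda>c. Im \<mu> *\<^sub>R u c + Re \<mu> *\<^sub>R w c)"
    unfolding differential_eigenvalue_def by blast
  \<comment> \<open>Choosing the chart used by \<open>differential\<close>, at both source and
    target since \<open>g x = x\<close>, turns the eigenvector equations into equations for the
    derivative of \<open>f\<close>.\<close>
  define c where "c = (SOME c. c \<in> charts_at \<A> x)"
  have c': "c \<in> charts_at \<A> x"
    unfolding c_def by (rule someI_ex[OF smooth_manifold_ex_chart[OF M x(1)]])
  then have c: "c \<in> \<A>" "x \<in> fst c" by (simp_all add: charts_at_def)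
  define f where "f = local_rep c c g"
  define G where "G = fst c \<inter> g -` fst c"
  note loc = C1_map_local[OF M M g c(1) c(1), folded f_def G_def]
  have xG: "x \<in> G" using c x by (simp add: G_def)
  then have p: "snd c x \<in> snd c ` G" by simp
  have D: "differential \<A> \<A> g x v c = frechet_derivative f (at (snd c x)) (v c)" for v
    using c' x(2) by (simp add: differential_def c_def[symmetric] Let_def f_def)
  have zero: "(\<lambda>_. 0) \<in> tangent_space \<A> x"
    using linear_0[OF has_derivative_linear[OF transition_has_derivative[OF M]]]
    by (simp add: tangent_space_def)
  have "u c \<noteq> 0 \<or> w c \<noteq> 0"
    using uw tangent_space_eqI[OF u zero c'] tangent_space_eqI[OF w zero c'] by blast
  then obtain r where r: "0 < r" "ball (snd c x) r \<subseteq> snd c ` G"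
    "negligible {z. \<forall>k. (f ^^ k) z \<in> ball (snd c x) r}"
    by (rule negligible_trapped_near_unstable_point[OF loc(2,3) p
          fun_cong[OF Du, of c, unfolded D] fun_cong[OF Dw, of c, unfolded D] _ \<mu>])
  define N where "N = G \<inter> {y \<in> fst c. snd c y \<in> ball (snd c x) r}"
  define W where "W = {y. \<forall>k. (g ^^ k) y \<in> N}"
  have N: "openin X N"
    unfolding N_def
    by (intro openin_Int loc(1) is_chart_open_vimage[OF smooth_manifold_chart[OF M c(1)]] open_ball)
  have xN: "x \<in> N" using xG c r by (simp add: N_def)
  have WN: "W \<subseteq> N" by (auto simp: W_def dest: spec[of _ 0])
  \<comment> \<open>The chart conjugates \<open>g\<close> to \<open>f\<close> only on
    \<open>fst c\<close>, so the induction uses that the whole orbit of \<open>y\<close> stays in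
    \<open>N\<close>.\<close>
  have "(f ^^ k) (snd c y) = snd c ((g ^^ k) y)" if "y \<in> W" for y k
  proof (induction k)
    case (Suc k)
    have "(g ^^ k) y \<in> fst c" using that by (simp add: W_def N_def)
    then show ?case
      using Suc by (simp add: f_def local_rep_apply[OF M c(1)])
  qed simp
  then have "snd c ` W \<subseteq> {z. \<forall>k. (f ^^ k) z \<in> ball (snd c x) r}"
    by (auto simp: W_def N_def)
  then have neg: "negligible (snd c ` W)"
    using r(3) negligible_subset by blast
  have "measure_zero X \<A> W"
  proof (rule measure_zeroI_local[OF M])
    show "W \<subseteq> topspace X" using WN openin_subset[OF N] by blast
    fix y assume "y \<in> W"
    moreover have "W \<inter> N = W" using WN by blast
    moreover have "N \<subseteq> fst c" by (auto simp: N_def)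
    ultimately show "\<exists>N c. openin X N \<and> y \<in> N \<and> c \<in> \<A> \<and> N \<subseteq> fst c \<and> negligible (snd c ` (W \<inter> N))"
      using N WN c(1) neg by (intro exI[of _ N] exI[of _ c]) auto
  qed
  then show ?thesis
    using N xN unfolding W_def by blast
qed

theorem theorem1p3:
  fixes X :: "'a topology" and \<A> :: "('a, 'n::finite) chart set" and g :: "'a \<Rightarrow> 'a"
  assumes "smooth_manifold X \<A>"
    and "C1_map X \<A> X \<A> g"
    and "almost_all X \<A> (invertible_differential \<A> \<A> g)"
  shows "measure_zero X \<A>
    {x0 \<in> topspace X. \<exists>x. unstable_fixed_point X \<A> g x \<and>
        limitin X (\<lambda>t. (g ^^ t) x0) x sequentially}"
  by (rule measure_zero_orbits_converging[OF assms unstable_fixed_point_trapped[OF assms(1,2)]])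

end
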